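(* Let $f\in C^2((0,\infty))$ be real-valued with $f(x)<0$ for all $x\in(0,\infty)$, and let $g:(0,\infty)\to\mathbb{C}$ be continuous. Assume that $\psi_{f,g}\in L^1(0,\infty)$. Then there exist two solutions $u_1$ and $u_2$ of $$u''(x)=(f(x)+g(x))\,u(x),\qquad x\in(0,\infty),$$ such that, setting $v_j(x):=|f(x)|^{1/4}u_j(x)$ for $j=1,2$, as $x\downarrow 0$, $$e^{-i\int_x^1|f(r)|^{1/2}\,dr}\,v_1(x)\to 1,\qquad |f(x)|^{-1/2}e^{-i\int_x^1|f(r)|^{1/2}\,dr}\,v_1'(x)\to -i,$$ $$e^{i\int_x^1|f(r)|^{1/2}\,dr}\,v_2(x)\to 1,\qquad |f(x)|^{-1/2}e^{i\int_x^1|f(r)|^{1/2}\,dr}\,v_2'(x)\to i.$$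
   Context: The function $\psi_{f,g}$ is defined by $$\psi_{f,g}(x):=|f(x)|^{-1/4}\left(-\frac{d^2}{dx^2}\bigl(|f|^{-1/4}\bigr)(x)+g(x)\,|f(x)|^{-1/4}\right).$$ A solution is a twice continuously differentiable complex-valued function on $(0,\infty)$ satisfying the equation pointwise. $L^1(I)$ denotes the absolutely integrable functions on the interval $I$. *)

theory Defs
  imports "HOL-Analysis.Analysis"
begin

text \<open>Meant for open \<open>S\<close> only: the derivatives are two-sided.\<close>

definition C2_differentiable_on :: "(real \<Rightarrow> 'a::real_normed_vector) \<Rightarrow> real set \<Rightarrow> bool"
    (infix "C2'_differentiable'_on" 50)
  where "u C2_differentiable_on S \<longleftrightarrow>
    (\<exists>D. (\<forall>x\<in>S. (u has_vector_derivative D x) (at x)) \<and> D C1_differentiable_on S)"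

text \<open>Functions on the half-line are total functions on \<open>real\<close>; their values outside
  \<open>{0<..}\<close> are irrelevant.\<close>

definition psi :: "(real \<Rightarrow> real) \<Rightarrow> (real \<Rightarrow> complex) \<Rightarrow> real \<Rightarrow> complex"
  where "psi f g x =
    of_real (\<bar>f x\<bar> powr (-1/4)) *
      (- of_real ((deriv ^^ 2) (\<lambda>t. \<bar>f t\<bar> powr (-1/4)) x)
       + g x * of_real (\<bar>f x\<bar> powr (-1/4)))"

definition is_solution :: "(real \<Rightarrow> real) \<Rightarrow> (real \<Rightarrow> complex) \<Rightarrow> (real \<Rightarrow> complex) \<Rightarrow> bool"
  where "is_solution f g u \<longleftrightarrow>
    u C2_differentiable_on {0<..} \<and>
    (\<forall>x>0. vector_derivative (\<lambda>t. vector_derivative u (at t)) (at x)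
            = (of_real (f x) + g x) * u x)"

definition rescaled :: "(real \<Rightarrow> real) \<Rightarrow> (real \<Rightarrow> complex) \<Rightarrow> real \<Rightarrow> complex"
  where "rescaled f u x = of_real (\<bar>f x\<bar> powr (1/4)) * u x"

text \<open>The integral of \<open>\<bar>f\<bar>\<^sup>1\<^sup>/\<^sup>2\<close> from \<open>x\<close> to \<open>1\<close>, used only for \<open>0 < x < 1\<close>
  (the interval is not oriented).\<close>

definition phase :: "(real \<Rightarrow> real) \<Rightarrow> real \<Rightarrow> real"
  where "phase f x = integral {x..1} (\<lambda>r. \<bar>f r\<bar> powr (1/2))"

end

theory Submission
  imports Defs
begin

text \<open>
  Put \<open>h = \<bar>f\<bar>\<^sup>-\<^sup>1\<^sup>/\<^sup>4\<close>, \<open>q = \<bar>f\<bar>\<^sup>1\<^sup>/\<^sup>2\<close>, \<open>u = h v\<close> and \<open>w = v' / q\<close>. The equation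
  for \<open>u\<close> becomes \<open>v' = q w\<close>, \<open>w' = (\<psi> - q) v\<close>. Let \<open>s' = -q\<close> and \<open>e = \<plusminus>\<i>\<close>. Variation of
  constants, \<open>v = A exp(e s) + B exp(-e s)\<close> and \<open>w = -e A exp(e s) + e B exp(-e s)\<close>, removes
  the unperturbed oscillation and leaves
  \<open>A' = (e/2) \<psi> (A + B exp(-2 e s))\<close>, \<open>B' = -(e/2) \<psi> (A exp(2 e s) + B)\<close>.
  Its coefficients are bounded by \<open>\<bar>\<psi>\<bar>\<close>, hence integrable up to \<open>0\<close>, so that it can be solved
  on the whole half-line with the initial value \<open>(A, B) = (1, 0)\<close> prescribed at the singular
  endpoint; the two signs of \<open>e\<close> give the two solutions.
\<close>

section \<open>Differential systems with a singular endpoint and an integrable Lipschitz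
  coefficient\<close>

text \<open>Constant continuation to the left of \<open>0\<close> makes the primitive an element of
  \<open>real \<Rightarrow>\<^sub>C 'b\<close> when it is bounded.\<close>

lemma dominated_primitive:
  fixes P :: "real \<Rightarrow> 'b::euclidean_space"
  assumes cont: "continuous_on {0<..} P"
    and k: "k integrable_on {0..}"
    and bound: "\<And>t. t \<ge> 0 \<Longrightarrow> norm (P t) \<le> k t"
  shows dominated_integrable: "P integrable_on {0..x}"
    and dominated_primitive_continuous: "continuous_on UNIV (\<lambda>x. integral {0..max 0 x} P)"
    and dominated_primitive_derivative:
      "x > 0 \<Longrightarrow> ((\<lambda>x. integral {0..max 0 x} P) has_vector_derivative P x) (at x)"
proof -
  \<comment> \<open>Continuity, hence measurability, of \<open>P\<close> is given on the open
    half-line only; adding or removing the endpoint changes a null set.\<close>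
  have k': "k integrable_on {0<..}"
    using k by (rule integrable_spike_set)
      (auto intro: negligible_subset[OF negligible_sing[of 0]])
  have "P integrable_on {0<..}"
    by (rule measurable_bounded_by_integrable_imp_integrable[OF _ k'])
      (auto intro!: continuous_imp_measurable_on_sets_lebesgue cont bound)
  then have P: "P integrable_on {0..}"
    by (rule integrable_spike_set) (auto intro: negligible_subset[OF negligible_sing[of 0]])
  then show int: "P integrable_on {0..x}" for x
    by (rule integrable_on_subinterval) auto
  have "continuous (at x) (\<lambda>x. integral {0..max 0 x} P)" for x
  proof -
    have "continuous_on {-1 - \<bar>x\<bar>..\<bar>x\<bar> + 1} (\<lambda>x. integral {0..max 0 x} P)"
      by (rule continuous_on_compose2[OF indefinite_integral_continuous_1[OF int, of "\<bar>x\<bar> + 1"]])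
        (auto intro!: continuous_intros)
    then show ?thesis
      by (rule continuous_on_interior) auto
  qed
  then show "continuous_on UNIV (\<lambda>x. integral {0..max 0 x} P)"
    by (simp add: continuous_on_eq_continuous_within)
  assume x: "x > 0"
  \<comment> \<open>\<open>P\<close> may be discontinuous at \<open>0\<close>, so the form of the
    fundamental theorem is used that asks for continuity at \<open>x\<close> alone; its exceptional
    set is taken empty.\<close>
  have "((\<lambda>u. integral {0..u} P) has_vector_derivative P x) (at x within {0..x + 1} - {})"
    by (rule integral_has_vector_derivative_continuous_at[OF int])
      (use x cont in \<open>auto intro: continuous_within_subset
        simp: continuous_on_eq_continuous_at intro: continuous_at_imp_continuous_at_within\<close>)
  then have "((\<lambda>u. integral {0..u} P) has_vector_derivative P x) (at x)"
    using x at_within_interior[of x "{0..x + 1}"] by simp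
  then show "((\<lambda>x. integral {0..max 0 x} P) has_vector_derivative P x) (at x)"
    by (rule has_vector_derivative_transform_within_open[of _ _ _ "{0<..}"]) (use x in auto)
qed

text \<open>Banach's fixed point theorem for the Volterra equation
  \<open>Y x = c + integral {0..x} (\<lambda>t. F t (Y t))\<close>. The Lipschitz bound and
  \<open>F t 0 = 0\<close> give \<open>norm (F t y) \<le> m t * norm y\<close>, so integrability of
  \<open>m\<close> makes the integral converge at \<open>0\<close> for bounded \<open>Y\<close>,
  even if \<open>F\<close> is singular there.\<close>

lemma singular_ODE_solution:
  fixes F :: "real \<Rightarrow> 'b::euclidean_space \<Rightarrow> 'b" and m :: "real \<Rightarrow> real"
  assumes F: "continuous_on ({0<..} \<times> UNIV) (\<lambda>(t, y). F t y)"
    and lip: "\<And>t y z. t > 0 \<Longrightarrow> norm (F t y - F t z) \<le> m t * norm (y - z)"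
    and F0: "\<And>t. t > 0 \<Longrightarrow> F t 0 = 0"
    and m: "continuous_on {0<..} m" "m integrable_on {0<..}" "\<And>t. t > 0 \<Longrightarrow> m t \<ge> 0"
  obtains Y where "\<And>x. x > 0 \<Longrightarrow> (Y has_vector_derivative F x (Y x)) (at x)"
    and "(Y \<longlongrightarrow> c) (at_right 0)"
proof -
  \<comment> \<open>Continuation by zero makes the Lipschitz and growth bounds hold for every real
    \<open>t\<close>, in particular at \<open>0\<close>.\<close>
  define m0 where "m0 t = (if t > 0 then m t else 0)" for t
  define G where "G t y = (if t > 0 then F t y else 0)" for t y
  have "m integrable_on {0..}"
    using m(2) by (rule integrable_spike_set) (auto intro: negligible_subset[OF negligible_sing[of 0]])
  then have m0_int: "m0 integrable_on {0..}"
    by (rule integrable_spike[where S = "{0}"]) (auto simp: m0_def)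
  have m0_nonneg: "m0 t \<ge> 0" for t
    using m(3) by (simp add: m0_def)
  have m0_cont: "continuous_on {0<..} m0"
    using m(1) by (rule continuous_on_eq) (simp add: m0_def)
  have lip0: "norm (G t y - G t z) \<le> m0 t * norm (y - z)" for t y z
    using lip by (simp add: G_def m0_def)
  have G_bound: "norm (G t y) \<le> m0 t * norm y" for t y
    using lip[of t y 0] F0 by (simp add: G_def m0_def)
  have m0_int_Icc: "m0 integrable_on {0..x}" for x
    by (rule dominated_integrable[OF m0_cont m0_int]) (simp add: m0_nonneg)
  define M where "M x = integral {0..max 0 x} m0" for x
  define K where "K = integral {0..} m0"
  have M_nonneg: "M x \<ge> 0" for x
    unfolding M_def by (rule integral_nonneg)
      (auto intro: m0_nonneg m0_int_Icc)
  have M_le: "M x \<le> K" for x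
    unfolding M_def K_def by (rule integral_subset_le)
      (auto simp: m0_nonneg m0_int m0_int_Icc)
  have M_cont: "continuous_on UNIV M"
    unfolding M_def by (rule dominated_primitive_continuous[OF m0_cont m0_int]) (simp add: m0_nonneg)
  have M_deriv: "(M has_real_derivative m0 x) (at x)" if "x > 0" for x
    unfolding M_def has_real_derivative_iff_has_vector_derivative
    by (rule dominated_primitive_derivative[OF m0_cont m0_int]) (use that m0_nonneg in auto)
  have M0: "M 0 = 0" by (simp add: M_def)
  \<comment> \<open>The unknown is \<open>Z = Y / E\<close>: as \<open>E' = 2 m E\<close>, the weight turns the Volterra operator into a
    contraction with factor \<open>1/2\<close> on the whole half-line.\<close>
  define E where "E x = exp (2 * M x)" for x
  have E_cont: "continuous_on S E" for S
    unfolding E_def by (intro continuous_intros continuous_on_subset[OF M_cont]) auto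
  have E_bounds: "1 \<le> E x" "E x \<le> exp (2 * K)" for x
    unfolding E_def using M_nonneg[of x] M_le[of x] by auto
  \<comment> \<open>\<open>m0 * E\<close> is the derivative of \<open>E / 2\<close>, but only for
    positive arguments; at \<open>0\<close> continuity of \<open>E\<close> suffices.\<close>
  have E_int: "((\<lambda>t. m0 t * E t) has_integral (E x - 1) / 2) {0..x}" if "x \<ge> 0" for x
  proof -
    have "((\<lambda>t. m0 t * E t) has_integral E x / 2 - E 0 / 2) {0..x}"
    proof (rule fundamental_theorem_of_calculus_interior[OF that])
      show "continuous_on {0..x} (\<lambda>t. E t / 2)"
        by (intro continuous_intros E_cont) auto
      show "((\<lambda>t. E t / 2) has_vector_derivative m0 t * E t) (at t)" if "t \<in> {0<..<x}" for t
        unfolding has_real_derivative_iff_has_vector_derivative[symmetric] E_def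
        by (rule derivative_eq_intros M_deriv refl | use that in simp)+
    qed
    then show ?thesis by (simp add: E_def M0 diff_divide_distrib)
  qed
  define P where "P Z t = G t (E t *\<^sub>R Z t)" for Z :: "real \<Rightarrow>\<^sub>C 'b" and t
  have P_cont: "continuous_on {0<..} (P Z)" for Z
  proof -
    have "continuous_on {0<..} (\<lambda>t. (\<lambda>(t, y). F t y) (t, E t *\<^sub>R Z t))"
      by (rule continuous_on_compose2[OF F]) (auto intro!: continuous_intros E_cont)
    then show ?thesis
      by (rule continuous_on_eq) (simp add: P_def G_def)
  qed
  \<comment> \<open>The weight is bounded because the total mass \<open>K\<close> of
    \<open>m0\<close> is finite, so one multiple of \<open>m0\<close> dominates the integrand on the
    whole half-line.\<close>
  have P_bound: "norm (P Z t) \<le> (exp (2 * K) * norm Z) * m0 t" for Z t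
  proof -
    have "norm (P Z t) \<le> m0 t * norm (E t *\<^sub>R Z t)"
      unfolding P_def by (rule G_bound)
    also have "\<dots> \<le> m0 t * (exp (2 * K) * norm Z)"
      using E_bounds[of t] norm_bounded[of Z t]
      by (intro mult_left_mono m0_nonneg) (auto intro!: mult_mono)
    finally show ?thesis by (simp add: mult_ac)
  qed
  have P_dom: "(\<lambda>t. (exp (2 * K) * norm Z) * m0 t) integrable_on {0..}" for Z :: "real \<Rightarrow>\<^sub>C 'b"
    using m0_int by (rule integrable_on_mult_right)
  note P_int = dominated_integrable[OF P_cont P_dom P_bound]
  define I where "I Z x = integral {0..max 0 x} (P Z)" for Z x
  have I_cont: "continuous_on S (I Z)" for Z S
    unfolding I_def using dominated_primitive_continuous[OF P_cont P_dom P_bound]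
    by (rule continuous_on_subset) auto
  have I_deriv: "(I Z has_vector_derivative P Z x) (at x)" if "x > 0" for Z x
    unfolding I_def by (rule dominated_primitive_derivative[OF P_cont P_dom P_bound]) (fact that)
  have I_diff: "norm (I Z x - I W x) \<le> E x * (dist Z W / 2)" for Z W x
  proof -
    let ?x = "max 0 x"
    have "I Z x - I W x = integral {0..?x} (\<lambda>t. P Z t - P W t)"
      unfolding I_def by (rule integral_diff[symmetric]) (rule P_int)+
    also have "norm \<dots> \<le> integral {0..?x} (\<lambda>t. dist Z W * (m0 t * E t))"
    proof (rule integral_norm_bound_integral)
      show "(\<lambda>t. P Z t - P W t) integrable_on {0..?x}"
        by (intro integrable_diff P_int)
      show "(\<lambda>t. dist Z W * (m0 t * E t)) integrable_on {0..?x}"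
        using E_int[of ?x] by (intro integrable_on_mult_right) auto
      fix t
      have "norm (P Z t - P W t) \<le> m0 t * norm (E t *\<^sub>R Z t - E t *\<^sub>R W t)"
        unfolding P_def by (rule lip0)
      also have "\<dots> = m0 t * (E t * dist (Z t) (W t))"
        using E_bounds(1)[of t] by (simp add: dist_norm flip: scaleR_diff_right)
      also have "\<dots> \<le> m0 t * (E t * dist Z W)"
        using E_bounds(1)[of t] by (intro mult_left_mono dist_bounded m0_nonneg) auto
      finally show "norm (P Z t - P W t) \<le> dist Z W * (m0 t * E t)"
        by (simp add: mult_ac)
    qed
    also have "\<dots> = dist Z W * ((E ?x - 1) / 2)"
      using has_integral_mult_right[OF E_int[of ?x]] by (intro integral_unique) auto
    \<comment> \<open>\<open>E ?x = E x\<close>, since \<open>M\<close> already truncates at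
      \<open>0\<close>. The remaining factor \<open>E x\<close> is the one that \<open>T\<close>
      divides out.\<close>
    also have "\<dots> \<le> dist Z W * (E x / 2)"
      by (intro mult_left_mono) (auto simp: E_def M_def)
    finally show ?thesis by (simp add: mult_ac)
  qed
  define T where "T Z = Bcontfun (\<lambda>x. (1 / E x) *\<^sub>R (c + I Z x))" for Z
  \<comment> \<open>The difference estimate against the zero function bounds \<open>I Z\<close>;
    with it the function inside \<open>Bcontfun\<close> is shown to be bounded, so that
    \<open>T Z\<close> has the intended values.\<close>
  have I_bound: "norm (I Z x) \<le> E x * (norm Z / 2)" for Z x
  proof -
    have "P 0 = (\<lambda>t. 0)" using G_bound[of _ 0] by (simp add: P_def fun_eq_iff)
    then have "I 0 x = 0" by (simp add: I_def)
    then show ?thesis using I_diff[of Z x 0] by simp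
  qed
  have T_apply: "T Z x = (1 / E x) *\<^sub>R (c + I Z x)" for Z x
  proof -
    have "(\<lambda>x. (1 / E x) *\<^sub>R (c + I Z x)) \<in> bcontfun"
    proof (rule bcontfun_normI)
      have "E x \<noteq> 0" for x using E_bounds(1)[of x] by auto
      then show "continuous_on UNIV (\<lambda>x. (1 / E x) *\<^sub>R (c + I Z x))"
        by (intro continuous_intros E_cont I_cont) auto
      fix x
      have "norm (c + I Z x) \<le> norm c + E x * (norm Z / 2)"
        using norm_triangle_ineq[of c "I Z x"] I_bound[of Z x] by linarith
      also have "\<dots> \<le> E x * (norm c + norm Z / 2)"
        using mult_right_mono[OF E_bounds(1)[of x], of "norm c"] by (simp add: algebra_simps)
      finally show "norm ((1 / E x) *\<^sub>R (c + I Z x)) \<le> norm c + norm Z / 2"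
        using E_bounds(1)[of x] by (simp add: divide_simps mult_ac)
    qed
    then show ?thesis by (simp add: T_def Bcontfun_inverse)
  qed
  have "dist (T Z) (T W) \<le> 1 / 2 * dist Z W" for Z W
  proof (rule dist_bound)
    fix x
    have "dist (T Z x) (T W x) = norm (I Z x - I W x) / E x"
      using E_bounds(1)[of x]
      by (simp add: T_apply dist_norm divide_inverse_commute flip: scaleR_diff_right)
    also have "\<dots> \<le> 1 / 2 * dist Z W"
      using I_diff[of Z x W] E_bounds(1)[of x] by (simp add: divide_simps mult_ac)
    finally show "dist (T Z x) (T W x) \<le> 1 / 2 * dist Z W" .
  qed
  then have "\<exists>!Z. T Z = Z"
    by (intro banach_fix_type[of "1/2"]) auto
  then obtain Z where Z: "T Z = Z" by blast
  define Y where "Y x = c + I Z x" for x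
  have EZ: "E x *\<^sub>R Z x = Y x" for x
    using E_bounds(1)[of x] by (subst Z[symmetric]) (simp add: T_apply Y_def)
  show ?thesis
  proof
    show "(Y has_vector_derivative F x (Y x)) (at x)" if "x > 0" for x
      using I_deriv[OF that, of Z] that
      by (simp add: P_def EZ G_def Y_def[abs_def] has_vector_derivative_add_const)
        (simp add: add.commute[of c] has_vector_derivative_add_const)
    \<comment> \<open>The constant continuation to the left makes \<open>Y\<close> continuous across
      \<open>0\<close>, so the initial value is read off as \<open>Y 0\<close>.\<close>
    have "isCont Y 0"
      using I_cont[of UNIV Z] unfolding Y_def
      by (intro continuous_intros) (simp add: continuous_on_eq_continuous_within)
    then have "(Y \<longlongrightarrow> Y 0) (at 0)" by (simp add: isCont_def)
    moreover have "Y 0 = c" by (simp add: Y_def I_def)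
    ultimately show "(Y \<longlongrightarrow> c) (at_right 0)"
      by (metis tendsto_within_subset subset_UNIV)
  qed
qed


section \<open>Phase and amplitude\<close>

text \<open>Continues the phase past \<open>1\<close>, where the unoriented integral is \<open>0\<close>.\<close>

lemma oriented_primitive:
  fixes q :: "real \<Rightarrow> real"
  assumes q: "continuous_on {0<..} q"
  obtains s where "\<And>x. x > 0 \<Longrightarrow> (s has_real_derivative - q x) (at x)"
    and "\<And>x. x \<le> 1 \<Longrightarrow> s x = integral {x..1} q"
proof
  define s where "s x = integral {x..1} q - integral {1..x} q" for x
  show "s x = integral {x..1} q" if "x \<le> 1" for x
    using that by (cases "x = 1") (auto simp: s_def)
  show "(s has_real_derivative - q x) (at x)" if x: "x > 0" for x
  proof -
    \<comment> \<open>\<open>a\<close> and \<open>b\<close> enclose both \<open>x\<close> and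
      \<open>1\<close> and stay away from \<open>0\<close>, so that near \<open>x\<close> the two
      unoriented integrals merge into one primitive based at \<open>a\<close>.\<close>
    define a where "a = min x 1 / 2"
    define b where "b = max x 1 + 1"
    have ab: "0 < a" "a < x" "a < 1" "x < b" "1 < b"
      using x by (auto simp: a_def b_def)
    have cont: "continuous_on {a..b} q"
      using q by (rule continuous_on_subset) (use ab in auto)
    have int: "q integrable_on {c..d}" if "a \<le> c" "d \<le> b" for c d
      by (rule integrable_continuous_real, rule continuous_on_subset[OF cont]) (use that in auto)
    have s: "s y = integral {a..1} q - integral {a..y} q" if y: "y \<in> {a<..<b}" for y
    proof (cases "y \<le> 1")
      case True
      then have "integral {a..y} q + integral {y..1} q = integral {a..1} q"
        using y ab by (intro Henstock_Kurzweil_Integration.integral_combine int) auto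
      moreover have "integral {1..y} q = 0"
        using True by (cases "y = 1") auto
      ultimately show ?thesis by (simp add: s_def)
    next
      case False
      then have "integral {a..1} q + integral {1..y} q = integral {a..y} q"
        using y ab by (intro Henstock_Kurzweil_Integration.integral_combine int) auto
      then show ?thesis using False by (simp add: s_def)
    qed
    have "((\<lambda>y. integral {a..y} q) has_real_derivative q x) (at x within {a..b})"
      by (rule integral_has_real_derivative[OF cont]) (use ab in auto)
    then have "((\<lambda>y. integral {a..y} q) has_real_derivative q x) (at x)"
      using ab at_within_interior[of x "{a..b}"] by simp
    then have "((\<lambda>y. integral {a..1} q - integral {a..y} q) has_real_derivative - q x) (at x)"
      by (auto intro!: derivative_eq_intros)
    then show ?thesis
      by (rule has_field_derivative_transform_within_open[of _ _ _ "{a<..<b}"]) (use ab s in auto)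
  qed
qed

text \<open>On the half-line \<open>\<bar>f\<bar> = - f\<close> is positive, so the power rule
  applies twice. Both derivatives are needed to differentiate \<open>u = h v\<close> twice, and
  continuity of the second makes \<open>psi\<close> continuous.\<close>

lemma C2_amplitude:
  fixes f :: "real \<Rightarrow> real"
  assumes f: "f C2_differentiable_on {0<..}" and neg: "\<And>x. x > 0 \<Longrightarrow> f x < 0"
  obtains h1 h2 where
    "\<And>x. x > 0 \<Longrightarrow> ((\<lambda>t. \<bar>f t\<bar> powr p) has_real_derivative h1 x) (at x)"
    "\<And>x. x > 0 \<Longrightarrow> (h1 has_real_derivative h2 x) (at x)"
    "continuous_on {0<..} h2"
proof -
  obtain f1 f2 where
    f1: "\<And>x. x > 0 \<Longrightarrow> (f has_real_derivative f1 x) (at x)" and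
    f2: "\<And>x. x > 0 \<Longrightarrow> (f1 has_real_derivative f2 x) (at x)" and
    f2_cont: "continuous_on {0<..} f2"
    using f unfolding C2_differentiable_on_def C1_differentiable_on_def
    by (auto simp: has_real_derivative_iff_has_vector_derivative)
  have f_cont: "continuous_on {0<..} f" "continuous_on {0<..} f1"
    by (rule DERIV_continuous_on[OF has_field_derivative_at_within[OF f1]],
        simp, rule DERIV_continuous_on[OF has_field_derivative_at_within[OF f2]], simp)
  define h1 where "h1 x = - (p * (- f x) powr (p - 1) * f1 x)" for x
  define h2 where "h2 x = p * (p - 1) * (- f x) powr (p - 2) * (f1 x)\<^sup>2
    - p * (- f x) powr (p - 1) * f2 x" for x
  show ?thesis
  proof
    fix x :: real assume x: "x > 0"
    have pow: "((\<lambda>t. (- f t) powr r) has_real_derivative - (r * (- f x) powr (r - 1) * f1 x)) (at x)"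
      for r
      using neg[OF x] by (auto intro!: derivative_eq_intros f1 x)
    from pow[of p] show "((\<lambda>t. \<bar>f t\<bar> powr p) has_real_derivative h1 x) (at x)"
      unfolding h1_def
      by (rule has_field_derivative_transform_within_open[of _ _ _ "{0<..}"])
        (use neg x in \<open>auto simp: abs_of_neg\<close>)
    show "(h1 has_real_derivative h2 x) (at x)"
      unfolding h1_def
      by (rule derivative_eq_intros pow f2 x refl)+
        (simp add: h2_def power2_eq_square algebra_simps)
  next
    show "continuous_on {0<..} h2"
      unfolding h2_def by (intro continuous_intros f_cont f2_cont) (use neg in force)+
  qed
qed

section \<open>Variation of constants and return to the original equation\<close>

text \<open>The parameter \<open>e\<close> treats both signs at once. As \<open>A\<close> tends to
  \<open>1\<close> and \<open>B\<close> to \<open>0\<close>, multiplying \<open>v\<close> by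
  \<open>exp (- e s)\<close> leaves \<open>A\<close> plus a vanishing term.\<close>

lemma oscillatory_solution:
  fixes f :: "real \<Rightarrow> real" and g :: "real \<Rightarrow> complex" and e :: complex
  assumes f: "f C2_differentiable_on {0<..}"
    and neg: "\<And>x. x > 0 \<Longrightarrow> f x < 0"
    and g: "continuous_on {0<..} g"
    and psi: "psi f g absolutely_integrable_on {0<..}"
    and e: "e = \<i> \<or> e = - \<i>"
  obtains u where "is_solution f g u"
    and "((\<lambda>x. exp (- e * of_real (phase f x)) * rescaled f u x) \<longlongrightarrow> 1) (at_right 0)"
    and "((\<lambda>x. of_real (\<bar>f x\<bar> powr (-1/2)) * exp (- e * of_real (phase f x))
            * vector_derivative (rescaled f u) (at x)) \<longlongrightarrow> - e) (at_right 0)"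
proof -
  define h where "h t = \<bar>f t\<bar> powr (-1/4)" for t
  define r where "r t = \<bar>f t\<bar> powr (1/4)" for t
  define q where "q t = \<bar>f t\<bar> powr (1/2)" for t
  obtain h1 h2 where
    h1: "\<And>x. x > 0 \<Longrightarrow> (h has_real_derivative h1 x) (at x)" and
    h2: "\<And>x. x > 0 \<Longrightarrow> (h1 has_real_derivative h2 x) (at x)" and
    h2_cont: "continuous_on {0<..} h2"
    using C2_amplitude[OF f neg, of "-1/4"] unfolding h_def[abs_def] by auto
  obtain f' where f': "\<And>x. x > 0 \<Longrightarrow> (f has_vector_derivative f' x) (at x)"
    using f unfolding C2_differentiable_on_def by auto
  have f_cont: "continuous_on {0<..} f"
    by (auto intro!: continuous_at_imp_continuous_on has_vector_derivative_continuous[OF f'])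
  have h_cont: "continuous_on {0<..} h"
    by (rule DERIV_continuous_on[OF has_field_derivative_at_within[OF h1]]) simp
  have q_cont: "continuous_on {0<..} q"
    unfolding q_def by (intro continuous_intros f_cont) (use neg in force)
  \<comment> \<open>These relations replace fractional powers by polynomials in \<open>h\<close> and
    \<open>r\<close>, which lets \<open>algebra\<close> prove the later identities.\<close>
  have hr: "h x * r x = 1" and qr: "q x = r x ^ 2" and fr: "f x = - (r x ^ 4)" if "x > 0" for x
    using neg[OF that]
    by (auto simp: h_def r_def q_def powr_power powr_add[symmetric] abs_of_neg)
  have r_eq: "r x = inverse (h x)" if "x > 0" for x
    using hr[OF that] by (metis inverse_unique)
  \<comment> \<open>Differentiating \<open>r\<close> as \<open>1 / h\<close> expresses its
    derivative through \<open>h1\<close>, which prepares a cancellation in the derivative of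
    \<open>D\<close>.\<close>
  have r_deriv: "(r has_real_derivative - (h1 x * (r x)\<^sup>2)) (at x)" if x: "x > 0" for x
  proof -
    have "h x \<noteq> 0" using hr[OF x] by auto
    then have "((\<lambda>t. inverse (h t)) has_real_derivative - (h1 x * (r x)\<^sup>2)) (at x)"
      by (auto intro!: derivative_eq_intros h1 x simp: r_eq[OF x] power2_eq_square)
    then show ?thesis
      by (rule has_field_derivative_transform_within_open[of _ _ _ "{0<..}"]) (use x r_eq in auto)
  qed
  have psi_eq: "psi f g x = of_real (h x) * (- of_real (h2 x) + g x * of_real (h x))"
    if x: "x > 0" for x
  proof -
    have "(deriv h has_real_derivative h2 x) (at x)"
      using h2[OF x]
      by (rule has_field_derivative_transform_within_open[of _ _ _ "{0<..}"])
        (use x h1 in \<open>auto intro: DERIV_imp_deriv[symmetric]\<close>)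
    then have "(deriv ^^ 2) h x = h2 x"
      by (simp add: numeral_2_eq_2 DERIV_imp_deriv)
    then show ?thesis by (simp add: psi_def h_def[abs_def])
  qed
  have psi_cont: "continuous_on {0<..} (psi f g)"
    by (subst continuous_on_cong[OF refl psi_eq]) (auto intro!: continuous_intros g h_cont h2_cont)
  obtain s where
    s: "\<And>x. x > 0 \<Longrightarrow> (s has_real_derivative - q x) (at x)" and
    s_phase: "\<And>x. x \<le> 1 \<Longrightarrow> s x = phase f x"
    using oriented_primitive[OF q_cont] unfolding phase_def q_def[abs_def] by blast
  have s_cont: "continuous_on {0<..} s"
    by (rule DERIV_continuous_on[OF has_field_derivative_at_within[OF s]]) simp
  have ee: "e * e = -1" using e by auto
  define P where "P x = exp (e * of_real (s x))" for x
  define N where "N x = exp (- e * of_real (s x))" for x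
  have PN: "P x * N x = 1" for x
    by (simp add: P_def N_def exp_minus)
  have PN_cont: "continuous_on {0<..} P" "continuous_on {0<..} N"
    unfolding P_def N_def by (auto intro!: continuous_intros s_cont)
  \<comment> \<open>\<open>e\<close> is imaginary and \<open>s\<close> real, so the oscillating
    factors do not enlarge the coefficients of the system.\<close>
  have PN_norm: "norm (P x) = 1" "norm (N x) = 1" for x
    using e by (auto simp: P_def N_def)
  have exp_deriv: "((\<lambda>x. exp (c * of_real (s x))) has_vector_derivative
      - c * of_real (q x) * exp (c * of_real (s x))) (at x)" if x: "x > 0" for c :: complex and x
  proof -
    have "((\<lambda>x. complex_of_real (s x)) has_vector_derivative of_real (- q x)) (at x)"
      using s[OF x] by (rule has_vector_derivative_of_real)
    moreover have "((\<lambda>z. exp (c * z)) has_field_derivative c * exp (c * of_real (s x)))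
        (at (complex_of_real (s x)))"
      by (auto intro!: derivative_eq_intros)
    ultimately show ?thesis
      using field_vector_diff_chain_at[of "\<lambda>x. complex_of_real (s x)"] by (fastforce simp: o_def mult_ac)
  qed
  define k where "k x = e / 2 * psi f g x" for x
  define F where "F t y = (k t * (fst y + snd y * (N t)\<^sup>2), - k t * (fst y * (P t)\<^sup>2 + snd y))"
    for t and y :: "complex \<times> complex"
  \<comment> \<open>Linearity in \<open>y\<close> reduces the Lipschitz estimate to the growth
    bound.\<close>
  have F_diff: "F t y - F t z = F t (y - z)" for t y z
    by (simp add: F_def algebra_simps)
  have F_bound: "norm (F t y) \<le> 2 * norm (psi f g t) * norm y" for t y
  proof -
    have y: "norm (fst y) \<le> norm y" "norm (snd y) \<le> norm y"
      by (metis norm_fst_le prod.collapse, metis norm_snd_le prod.collapse)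
    have "norm (fst y + snd y * (N t)\<^sup>2) \<le> 2 * norm y"
      using norm_triangle_ineq[of "fst y" "snd y * (N t)\<^sup>2"] y PN_norm
      by (simp add: norm_mult norm_power)
    moreover have "norm (fst y * (P t)\<^sup>2 + snd y) \<le> 2 * norm y"
      using norm_triangle_ineq[of "fst y * (P t)\<^sup>2" "snd y"] y PN_norm
      by (simp add: norm_mult norm_power)
    moreover have k: "norm (k t) = norm (psi f g t) / 2"
      using e by (auto simp: k_def norm_mult norm_divide)
    ultimately have "norm (fst (F t y)) \<le> norm (psi f g t) / 2 * (2 * norm y)"
      "norm (snd (F t y)) \<le> norm (psi f g t) / 2 * (2 * norm y)"
      unfolding F_def fst_conv snd_conv norm_mult norm_minus_cancel k
      by (intro mult_left_mono; simp)+
    moreover have "norm (F t y) \<le> norm (fst (F t y)) + norm (snd (F t y))"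
      by (metis norm_Pair_le prod.collapse)
    ultimately show ?thesis by simp
  qed
  have F_cont: "continuous_on ({0<..} \<times> UNIV) (\<lambda>(t, y). F t y)"
    unfolding F_def k_def case_prod_unfold
    by (intro continuous_intros continuous_on_compose2[OF psi_cont]
      continuous_on_compose2[OF PN_cont(1)] continuous_on_compose2[OF PN_cont(2)]) auto
  obtain Y where Y: "\<And>x. x > 0 \<Longrightarrow> (Y has_vector_derivative F x (Y x)) (at x)"
    and Y_lim: "(Y \<longlongrightarrow> (1, 0)) (at_right 0)"
  proof (rule singular_ODE_solution[OF F_cont, of "\<lambda>t. 2 * norm (psi f g t)" "(1, 0)"])
    show "norm (F t y - F t z) \<le> 2 * norm (psi f g t) * norm (y - z)" for t y z
      unfolding F_diff by (rule F_bound)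
    show "F t 0 = 0" for t by (simp add: F_def zero_prod_def)
    show "continuous_on {0<..} (\<lambda>t. 2 * norm (psi f g t))"
      by (intro continuous_intros psi_cont)
    show "(\<lambda>t. 2 * norm (psi f g t)) integrable_on {0<..}"
      using psi by (intro integrable_on_mult_right) (simp add: absolutely_integrable_on_def)
  qed auto
  define A where "A x = fst (Y x)" for x
  define B where "B x = snd (Y x)" for x
  have A: "(A has_vector_derivative k x * (A x + B x * (N x)\<^sup>2)) (at x)"
    and B: "(B has_vector_derivative - k x * (A x * (P x)\<^sup>2 + B x)) (at x)" if "x > 0" for x
    using bounded_linear.has_vector_derivative[OF bounded_linear_fst Y[OF that]]
      bounded_linear.has_vector_derivative[OF bounded_linear_snd Y[OF that]]
    by (simp_all add: A_def[abs_def] B_def[abs_def] F_def)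
  have P: "(P has_vector_derivative - e * of_real (q x) * P x) (at x)"
    and N: "(N has_vector_derivative e * of_real (q x) * N x) (at x)" if "x > 0" for x
    using exp_deriv[OF that, of e] exp_deriv[OF that, of "- e"]
    by (simp_all add: P_def[abs_def] N_def[abs_def])
  define v where "v x = A x * P x + B x * N x" for x
  define w where "w x = e * (B x * N x - A x * P x)" for x
  have v: "(v has_vector_derivative of_real (q x) * w x) (at x)" if x: "x > 0" for x
  proof -
    \<comment> \<open>Since \<open>P N = 1\<close>, the terms with \<open>k\<close> cancel: this is
      the defining condition of variation of constants.\<close>
    have eq: "of_real (q x) * w x =
      (A x * (- e * of_real (q x) * P x) + k x * (A x + B x * (N x)\<^sup>2) * P x) +
      (B x * (e * of_real (q x) * N x) + - k x * (A x * (P x)\<^sup>2 + B x) * N x)"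
      using PN[of x] unfolding w_def by algebra
    show ?thesis
      unfolding eq v_def[abs_def]
      by (intro has_vector_derivative_add has_vector_derivative_mult A B P N x)
  qed
  have w: "(w has_vector_derivative (psi f g x - of_real (q x)) * v x) (at x)" if x: "x > 0" for x
  proof -
    \<comment> \<open>Here the terms with \<open>k\<close> add up to \<open>- 2 e k v\<close>, which
      is \<open>psi v\<close> because \<open>e * e = -1\<close>.\<close>
    have "2 * k x = e * psi f g x" by (simp add: k_def)
    then have eq: "(psi f g x - of_real (q x)) * v x = e * (
      (B x * (e * of_real (q x) * N x) + - k x * (A x * (P x)\<^sup>2 + B x) * N x) -
      (A x * (- e * of_real (q x) * P x) + k x * (A x + B x * (N x)\<^sup>2) * P x))"
      using PN[of x] ee unfolding v_def by algebra
    show ?thesis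
      unfolding eq w_def[abs_def]
      by (intro has_vector_derivative_mult_right has_vector_derivative_diff
        has_vector_derivative_mult A B P N x)
  qed
  define u where "u x = of_real (h x) * v x" for x
  \<comment> \<open>\<open>u' = h' v + h q w\<close>, and \<open>h q = r\<close>\<close>
  define D where "D x = of_real (h1 x) * v x + of_real (r x) * w x" for x
  have u: "(u has_vector_derivative D x) (at x)" if x: "x > 0" for x
  proof -
    have "complex_of_real (h x * r x) = 1" "complex_of_real (q x) = of_real (r x ^ 2)"
      by (simp_all only: hr[OF x] qr[OF x] of_real_1)
    then have "D x = of_real (h x) * (of_real (q x) * w x) + of_real (h1 x) * v x"
      unfolding D_def of_real_mult of_real_power by algebra
    then show ?thesis
      unfolding u_def[abs_def]
      using has_vector_derivative_mult[OF has_vector_derivative_of_real[OF h1[OF x]] v[OF x]] by simp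
  qed
  have D: "(D has_vector_derivative (of_real (f x) + g x) * u x) (at x)" if x: "x > 0" for x
  proof -
    have "complex_of_real (h x * r x) = 1" "complex_of_real (q x) = of_real (r x ^ 2)"
      "complex_of_real (f x) = of_real (- (r x ^ 4))"
      by (simp_all only: hr[OF x] qr[OF x] fr[OF x] of_real_1)
    \<comment> \<open>The \<open>w\<close> terms cancel as \<open>q = r^2\<close>. In the
      \<open>v\<close> terms \<open>h r = 1\<close> turns \<open>r psi\<close> into
      \<open>- h2 + g h\<close>, which removes \<open>h2\<close>, and
      \<open>- r q = - r^3 = f h\<close>.\<close>
    then have "(of_real (f x) + g x) * u x =
      (of_real (h1 x) * (of_real (q x) * w x) + of_real (h2 x) * v x) +
      (of_real (r x) * ((psi f g x - of_real (q x)) * v x) + of_real (- (h1 x * (r x)\<^sup>2)) * w x)"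
      unfolding u_def psi_eq[OF x] of_real_mult of_real_power of_real_minus by algebra
    then show ?thesis
      unfolding D_def[abs_def]
      using has_vector_derivative_add[OF
        has_vector_derivative_mult[OF has_vector_derivative_of_real[OF h2[OF x]] v[OF x]]
        has_vector_derivative_mult[OF has_vector_derivative_of_real[OF r_deriv[OF x]] w[OF x]]] by simp
  qed
  have rescaled: "rescaled f u x = v x" if "x > 0" for x
  proof -
    have "of_real (r x) * complex_of_real (h x) = 1"
      using hr[OF that] by (metis mult.commute of_real_1 of_real_mult)
    then show ?thesis by (simp add: rescaled_def u_def r_def[symmetric] mult.assoc[symmetric])
  qed
  have rescaled_deriv: "vector_derivative (rescaled f u) (at x) = of_real (q x) * w x"
    if "x > 0" for x
    by (rule vector_derivative_at,
      rule has_vector_derivative_transform_within_open[OF v[OF that], of "{0<..}"])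
      (use that rescaled in auto)
  have A_lim: "(A \<longlongrightarrow> 1) (at_right 0)" and B_lim: "(B \<longlongrightarrow> 0) (at_right 0)"
    unfolding A_def[abs_def] B_def[abs_def] using tendsto_fst[OF Y_lim] tendsto_snd[OF Y_lim] by auto
  \<comment> \<open>\<open>N\<close> itself need not converge, but it is unimodular and
    \<open>B\<close> tends to \<open>0\<close>.\<close>
  have BN_lim: "((\<lambda>x. B x * (N x)\<^sup>2) \<longlongrightarrow> 0) (at_right 0)"
    by (rule tendsto_norm_zero_cancel)
      (use tendsto_norm_zero[OF B_lim] in \<open>simp add: norm_mult norm_power PN_norm\<close>)
  have near: "eventually (\<lambda>x::real. 0 < x \<and> x < 1) (at_right 0)"
    by (auto simp: eventually_at_right_field intro!: exI[of _ 1])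
  show ?thesis
  proof
    have u_cont: "continuous_on {0<..} u"
      by (auto intro!: continuous_at_imp_continuous_on has_vector_derivative_continuous[OF u])
    \<comment> \<open>The equation itself exhibits the derivative of \<open>D\<close> as
      continuous.\<close>
    have "D C1_differentiable_on {0<..}"
      unfolding C1_differentiable_on_def
      by (rule exI[of _ "\<lambda>x. (of_real (f x) + g x) * u x"])
        (auto intro!: D continuous_intros f_cont g u_cont)
    then have "u C2_differentiable_on {0<..}"
      unfolding C2_differentiable_on_def using u by auto
    moreover have "vector_derivative (\<lambda>t. vector_derivative u (at t)) (at x)
        = (of_real (f x) + g x) * u x" if "x > 0" for x
      by (rule vector_derivative_at,
        rule has_vector_derivative_transform_within_open[OF D[OF that], of "{0<..}"])
        (use that in \<open>auto simp: vector_derivative_at[OF u]\<close>)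
    ultimately show "is_solution f g u" by (simp add: is_solution_def)
    have "((\<lambda>x. A x + B x * (N x)\<^sup>2) \<longlongrightarrow> 1) (at_right 0)"
      using tendsto_add[OF A_lim BN_lim] by simp
    then show "((\<lambda>x. exp (- e * of_real (phase f x)) * rescaled f u x) \<longlongrightarrow> 1) (at_right 0)"
    proof (rule Lim_transform_eventually, use near in eventually_elim)
      case (elim x)
      have "N x * v x = A x + B x * (N x)\<^sup>2"
        using PN[of x] unfolding v_def by algebra
      then show ?case using elim by (simp add: rescaled N_def s_phase)
    qed
    have "((\<lambda>x. e * (B x * (N x)\<^sup>2 - A x)) \<longlongrightarrow> - e) (at_right 0)"
      using tendsto_mult_left[OF tendsto_diff[OF BN_lim A_lim], of e] by simp
    then show "((\<lambda>x. of_real (\<bar>f x\<bar> powr (-1/2)) * exp (- e * of_real (phase f x))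
            * vector_derivative (rescaled f u) (at x)) \<longlongrightarrow> - e) (at_right 0)"
    proof (rule Lim_transform_eventually, use near in eventually_elim)
      case (elim x)
      \<comment> \<open>The weight cancels the factor \<open>q\<close> of \<open>v' = q w\<close>,
        leaving \<open>N w = e (B N^2 - A)\<close>, whose limit is \<open>- e\<close>.\<close>
      have "\<bar>f x\<bar> powr (-1/2) * q x = 1"
        using neg[of x] elim by (simp add: q_def powr_add[symmetric])
      then have "of_real (\<bar>f x\<bar> powr (-1/2)) * complex_of_real (q x) = 1"
        by (metis of_real_1 of_real_mult)
      moreover have "N x = exp (- e * of_real (phase f x))"
        using elim by (simp add: N_def s_phase)
      ultimately show ?case
        using PN[of x] elim unfolding rescaled_deriv[OF conjunct1[OF elim]] w_def by algebra
    qed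
  qed
qed

theorem proposition4p2:
  fixes f :: "real \<Rightarrow> real" and g :: "real \<Rightarrow> complex"
  assumes "f C2_differentiable_on {0<..}"
    and "\<And>x. x > 0 \<Longrightarrow> f x < 0"
    and "continuous_on {0<..} g"
    and "psi f g absolutely_integrable_on {0<..}"
  shows "\<exists>u1 u2. is_solution f g u1 \<and> is_solution f g u2 \<and>
    ((\<lambda>x. exp (- \<i> * of_real (phase f x)) * rescaled f u1 x) \<longlongrightarrow> 1) (at_right 0) \<and>
    ((\<lambda>x. of_real (\<bar>f x\<bar> powr (-1/2)) * exp (- \<i> * of_real (phase f x))
            * vector_derivative (rescaled f u1) (at x)) \<longlongrightarrow> - \<i>) (at_right 0) \<and>
    ((\<lambda>x. exp (\<i> * of_real (phase f x)) * rescaled f u2 x) \<longlongrightarrow> 1) (at_right 0) \<and>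
    ((\<lambda>x. of_real (\<bar>f x\<bar> powr (-1/2)) * exp (\<i> * of_real (phase f x))
            * vector_derivative (rescaled f u2) (at x)) \<longlongrightarrow> \<i>) (at_right 0)"
proof -
  note solution = oscillatory_solution[OF assms]
  obtain u1 where "is_solution f g u1"
    "((\<lambda>x. exp (- \<i> * of_real (phase f x)) * rescaled f u1 x) \<longlongrightarrow> 1) (at_right 0)"
    "((\<lambda>x. of_real (\<bar>f x\<bar> powr (-1/2)) * exp (- \<i> * of_real (phase f x))
            * vector_derivative (rescaled f u1) (at x)) \<longlongrightarrow> - \<i>) (at_right 0)"
    by (rule solution[of \<i>]) auto
  moreover obtain u2 where "is_solution f g u2"
    "((\<lambda>x. exp (\<i> * of_real (phase f x)) * rescaled f u2 x) \<longlongrightarrow> 1) (at_right 0)"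
    "((\<lambda>x. of_real (\<bar>f x\<bar> powr (-1/2)) * exp (\<i> * of_real (phase f x))
            * vector_derivative (rescaled f u2) (at x)) \<longlongrightarrow> \<i>) (at_right 0)"
    by (rule solution[of "- \<i>"]) auto
  ultimately show ?thesis by blast
qed

end
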